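(* Let $X$ be an mm-space, $\nu$ a Borel probability measure on $\mathbb{R}$, and $\varepsilon\ge 0$ a real number. Define \[ \Delta(\operatorname{supp}\nu):=\sup\{\delta_\nu^-(a)\mid a\in\operatorname{supp}\nu\setminus\{\inf\operatorname{supp}\nu\}\},\qquad \delta_\nu^-(a):=\inf\{t>0\mid a-t\in\operatorname{supp}\nu\}. \] Then the following (1) and (2) hold. (1) If $\inf\operatorname{supp}\nu>-\infty$, assume that $\nu(\{\inf\operatorname{supp}\nu\})\le m_X(\{x\})$ for every $x\in\operatorname{supp} m_X$ (if $\inf\operatorname{supp}\nu=-\infty$, nothing is assumed). If $X$ satisfies $\mathrm{ICL}_\varepsilon(\nu)$, then $\nu$ is an $(\varepsilon+\Delta(\operatorname{supp}\nu))$-iso-dominant of $X$. (2) Assume that $\operatorname{supp}\nu$ is connected or that $\nu(\{x\})>0$ for all $x\in\operatorname{supp}\nu$. If $\nu$ is an $\varepsilon$-iso-dominant of $X$, then $X$ satisfies $\mathrm{ICL}_{2\varepsilon}(\nu)$.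
   Context: An mm-space is a triple $X=(X,d_X,m_X)$ where $(X,d_X)$ is a complete separable metric space and $m_X$ is a Borel probability measure on $X$. $\operatorname{supp}$ denotes the support of a measure. For $A\subset X$ and $r\ge 0$, $B_r(A):=\{y\in X\mid d_X(y,A)\le r\}$ with $d_X(y,A)=\inf_{z\in A}d_X(y,z)$. $F_\nu(t):=\nu((-\infty,t])$ is the cumulative distribution function of $\nu$. For $\varepsilon\ge 0$, $X$ satisfies $\mathrm{ICL}_\varepsilon(\nu)$ if $F_\nu(b)\le m_X(B_{b-a+\varepsilon}(A))$ for all $a,b\in\operatorname{supp}\nu$ with $a\le b$ and every Borel subset $A\subset X$ with $m_X(A)>0$ and $F_\nu(a)\le m_X(A)$. The 1-measurement of $X$ is $\mathcal{M}(X;1):=\{\varphi_*m_X\mid \varphi:X\to\mathbb{R}\ \text{1-Lipschitz}\}$, where $\varphi_*m_X$ is the push-forward measure and 1-Lipschitz means Lipschitz constant at most $1$. For $S\subset\mathbb{R}^2$, the iso-deviation is $\operatorname{dev}_\succ S:=\sup\{y-y'-\max\{x-x',0\}\mid (x,y),(x',y')\in S\}$. For Borel probability measures $\mu,\nu$ on $\mathbb{R}$, $\Pi(\mu,\nu)$ is the set of Borel probability measures on $\mathbb{R}^2$ with first marginal $\mu$ and second marginal $\nu$. For $s,t\ge 0$, write $\mu\succ'_{(s,t)}\nu$ if there exist $\pi\in\Pi(\mu,\nu)$ and a Borel set $S\subset\mathbb{R}^2$ with $\operatorname{dev}_\succ S\le s$ and $1-\pi(S)\le t$. For $\varepsilon\ge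 0$, $\nu$ is an $\varepsilon$-iso-dominant of $X$ if $\nu\succ'_{(\varepsilon,0)}\mu$ for all $\mu\in\mathcal{M}(X;1)$. Conventions: the supremum defining $\Delta(\operatorname{supp}\nu)$ is $0$ when taken over the empty set (i.e. when $\operatorname{supp}\nu$ is a single point); if $\Delta(\operatorname{supp}\nu)=\infty$ the conclusion of (1) is vacuous. *)

theory Defs
  imports "HOL-Probability.Probability"
begin

definition borel_prob :: "'a::topological_space measure \<Rightarrow> bool" where
  "borel_prob M \<longleftrightarrow> prob_space M \<and> sets M = sets borel"

text \<open>
  An mm-space is a Polish metric space, given here as a type of class \<open>polish_space\<close>
  (complete and second countable metric), together with a Borel probability measure on it.
\<close>
definition mm_space :: "'a::polish_space measure \<Rightarrow> bool" where
  "mm_space X \<longleftrightarrow> borel_prob X"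

definition msupp :: "'a::topological_space measure \<Rightarrow> 'a set" where
  "msupp M = {x. \<forall>U. open U \<and> x \<in> U \<longrightarrow> 0 < measure M U}"

text \<open>
  The guard \<open>A \<noteq> {}\<close> is needed because \<open>infdist y {} = 0\<close>, whereas the infimum of the
  distances to the empty set is infinite.
\<close>
definition closed_nbhd :: "real \<Rightarrow> 'a::metric_space set \<Rightarrow> 'a set" where
  "closed_nbhd r A = {y. A \<noteq> {} \<and> infdist y A \<le> r}"

definition ICL :: "real \<Rightarrow> real measure \<Rightarrow> 'a::polish_space measure \<Rightarrow> bool" where
  "ICL \<epsilon> \<nu> X \<longleftrightarrow>
    (\<forall>a\<in>msupp \<nu>. \<forall>b\<in>msupp \<nu>. \<forall>A\<in>sets borel.
      a \<le> b \<and> 0 < measure X A \<and> cdf \<nu> a \<le> measure X A \<longrightarrow>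
      cdf \<nu> b \<le> measure X (closed_nbhd (b - a + \<epsilon>) A))"

definition one_measurement :: "'a::polish_space measure \<Rightarrow> real measure set" where
  "one_measurement X = {distr X borel \<phi> | \<phi>. 1-lipschitz_on UNIV \<phi>}"

definition iso_dev :: "(real \<times> real) set \<Rightarrow> ereal" where
  "iso_dev S = Sup {ereal (y - y' - max (x - x') 0) | x y x' y'. (x, y) \<in> S \<and> (x', y') \<in> S}"

definition couplings :: "real measure \<Rightarrow> real measure \<Rightarrow> (real \<times> real) measure set" where
  "couplings \<mu> \<nu> = {\<pi>. borel_prob \<pi> \<and> distr \<pi> borel fst = \<mu> \<and> distr \<pi> borel snd = \<nu>}"

text \<open>\<open>iso_dominates s t \<mu> \<nu>\<close> is the relation $\mu \succ'_{(s,t)} \nu$.\<close>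
definition iso_dominates :: "real \<Rightarrow> real \<Rightarrow> real measure \<Rightarrow> real measure \<Rightarrow> bool" where
  "iso_dominates s t \<mu> \<nu> \<longleftrightarrow>
    (\<exists>\<pi>\<in>couplings \<mu> \<nu>. \<exists>S\<in>sets borel. iso_dev S \<le> ereal s \<and> 1 - measure \<pi> S \<le> t)"

definition iso_dominant :: "real \<Rightarrow> real measure \<Rightarrow> 'a::polish_space measure \<Rightarrow> bool" where
  "iso_dominant \<epsilon> \<nu> X \<longleftrightarrow> (\<forall>\<mu>\<in>one_measurement X. iso_dominates \<epsilon> 0 \<nu> \<mu>)"

definition inf_supp :: "real measure \<Rightarrow> ereal" where
  "inf_supp \<nu> = Inf (ereal ` msupp \<nu>)"

definition delta_minus :: "real measure \<Rightarrow> real \<Rightarrow> ennreal" where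
  "delta_minus \<nu> a = Inf {ennreal t | t. 0 < t \<and> a - t \<in> msupp \<nu>}"

text \<open>
  In \<open>ennreal\<close> the supremum of the empty set is \<open>0\<close>, which is the convention wanted when the
  support is a single point. If the support is unbounded below, \<open>inf_supp \<nu> = -\<infinity>\<close> and no
  point is excluded.
\<close>
definition Delta_supp :: "real measure \<Rightarrow> ennreal" where
  "Delta_supp \<nu> = (SUP a\<in>{a \<in> msupp \<nu>. ereal a \<noteq> inf_supp \<nu>}. delta_minus \<nu> a)"

end

theory Submission
  imports Defs
begin

text \<open>
  Part (1) rests on the monotone coupling: parametrize \<open>\<nu>\<close> and \<open>\<mu> = \<phi>\<^sub>*m\<^sub>X\<close> by their quantile
  functions over \<open>(0,1)\<close>. Only parameters \<open>v < u\<close> matter, since otherwise the second coordinate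
  does not increase. Put \<open>A = {\<phi> \<le> q\<^sub>\<mu>(v)}\<close>, which has mass at least \<open>v\<close>. The isoperimetric
  condition enlarges \<open>A\<close> to a set of mass at least \<open>F\<^sub>\<nu>(q\<^sub>\<nu>(u)) \<ge> u\<close>, and \<open>\<phi>\<close>, being 1-Lipschitz,
  exceeds \<open>q\<^sub>\<mu>(v)\<close> there by at most the radius; this bounds \<open>q\<^sub>\<mu>(u) - q\<^sub>\<mu>(v)\<close>
  (\<open>ICL_quantile_le\<close>). To apply the condition one needs a starting point \<open>c\<close> in the support with
  \<open>F\<^sub>\<nu>(c) \<le> m\<^sub>X(A)\<close>. The point \<open>q\<^sub>\<nu>(v)\<close> itself may fail because of an atom; then any smaller
  point \<open>c\<close> of the support works, since \<open>F\<^sub>\<nu>(c) < v\<close> there, and the loss \<open>q\<^sub>\<nu>(v) - c\<close> can be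
  made at most \<open>\<Delta>(supp \<nu>)\<close> up to an arbitrarily small error. The least point of the support has
  no predecessor. If \<open>q\<^sub>\<nu>(v)\<close> is that point, then \<open>F\<^sub>\<nu>(q\<^sub>\<nu>(v))\<close> is the mass of its atom, and \<open>A\<close>,
  having positive mass, contains a point of \<open>supp m\<^sub>X\<close>, whose mass is at least as large by
  hypothesis; so \<open>q\<^sub>\<nu>(v)\<close> is admissible.

  Part (2) tests the domination on the 1-Lipschitz function \<open>d(\<cdot>, A)\<close>. Its law puts on \<open>0\<close> a
  mass that is positive and at least \<open>F\<^sub>\<nu>(a)\<close>. In a coupling with \<open>\<nu>\<close> this mass cannot all lie
  over \<open>(-\<infinity>, a - \<eta>]\<close>, because \<open>F\<^sub>\<nu>(a - \<eta>)\<close> is either \<open>0\<close> or smaller than \<open>F\<^sub>\<nu>(a)\<close>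
  (\<open>cdf_less_at_msupp\<close>). So \<open>S\<close> contains a point \<open>(x', 0)\<close> with \<open>x' > a - \<eta>\<close>, and comparison
  with it bounds by \<open>b - a + \<epsilon> + \<eta>\<close> the second coordinate of every point of \<open>S\<close> over
  \<open>(-\<infinity>, b]\<close>. Letting \<open>\<eta>\<close> tend to \<open>0\<close> gives the isoperimetric condition already with \<open>\<epsilon>\<close>,
  and it is monotone in \<open>\<epsilon>\<close>.
\<close>

section \<open>Supports\<close>

text \<open>Second countability reduces the union of all null open sets to a countable one.\<close>

lemma measure_outside_msupp:
  fixes M :: "'a::second_countable_topology measure"
  assumes "borel_prob M" and B: "B \<in> sets borel" and disj: "B \<inter> msupp M = {}"
  shows "measure M B = 0"
proof -
  interpret prob_space M using assms(1) by (simp add: borel_prob_def)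
  have sets_M: "sets M = sets borel" using assms(1) by (simp add: borel_prob_def)
  let ?\<F> = "{U. open U \<and> measure M U = 0}"
  obtain \<F> where \<F>: "\<F> \<subseteq> ?\<F>" "countable \<F>" "\<Union>\<F> = \<Union>?\<F>"
    using Lindelof[of ?\<F>] by auto
  have "U \<in> null_sets M" if "U \<in> \<F>" for U
    using that \<F>(1) by (auto simp: null_sets_def sets_M emeasure_eq_measure)
  then have null: "\<Union>\<F> \<in> null_sets M"
    using null_sets_UN'[OF \<F>(2), of "\<lambda>U. U" M] by simp
  have "B \<subseteq> \<Union>?\<F>"
  proof
    fix x assume "x \<in> B"
    then have "x \<notin> msupp M" using disj by blast
    then obtain U where "open U" "x \<in> U" "\<not> 0 < measure M U"
      by (auto simp: msupp_def)
    then show "x \<in> \<Union>?\<F>"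
      using measure_nonneg[of M U] by auto
  qed
  then have "B \<in> null_sets M"
    using null_sets_subset[OF null, of B] B \<F>(3) sets_M by auto
  then show ?thesis by (simp add: null_sets_def measure_def)
qed

lemma positive_measure_meets_msupp:
  fixes M :: "'a::second_countable_topology measure"
  assumes "borel_prob M" "B \<in> sets borel" "0 < measure M B"
  obtains x where "x \<in> B" "x \<in> msupp M"
  using measure_outside_msupp[OF assms(1,2)] assms(3) by fastforce

lemma borel_prob_real_distribution:
  "borel_prob \<nu> \<Longrightarrow> real_distribution \<nu>"
  by (auto simp: borel_prob_def real_distribution_def real_distribution_axioms_def)

lemma cdf_inf_supp:
  assumes \<nu>: "borel_prob \<nu>" and a: "ereal a = inf_supp \<nu>"
  shows "cdf \<nu> a = measure \<nu> {a}"
proof -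
  interpret real_distribution \<nu> using \<nu> by (rule borel_prob_real_distribution)
  have "a \<le> x" if "x \<in> msupp \<nu>" for x
  proof -
    have "inf_supp \<nu> \<le> ereal x" unfolding inf_supp_def using that by (intro Inf_lower) auto
    then show ?thesis using a by (metis ereal_less_eq(3))
  qed
  then have "measure \<nu> {..<a} = 0"
    by (intro measure_outside_msupp[OF \<nu>]) force+
  moreover have "cdf \<nu> a = measure \<nu> {..<a} + measure \<nu> {a}"
    unfolding cdf_def ivl_disj_un(2)[symmetric] by (subst finite_measure_Union) auto
  ultimately show ?thesis by simp
qed

lemma msupp_predecessor_within_Delta:
  assumes "a \<in> msupp \<nu>" "ereal a \<noteq> inf_supp \<nu>" "Delta_supp \<nu> < \<infinity>" "0 < \<eta>"
  obtains c where "c \<in> msupp \<nu>" "c < a" "a - c < enn2real (Delta_supp \<nu>) + \<eta>"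
proof -
  define D where "D = enn2real (Delta_supp \<nu>)"
  have D: "Delta_supp \<nu> = ennreal D" "0 \<le> D"
    using assms(3) by (auto simp: D_def)
  have "delta_minus \<nu> a \<le> Delta_supp \<nu>"
    unfolding Delta_supp_def using assms(1,2) by (intro SUP_upper) auto
  also have "\<dots> < ennreal (D + \<eta>)"
    using D assms(4) by (simp add: ennreal_less_iff)
  finally obtain t where "0 < t" "a - t \<in> msupp \<nu>" "ennreal t < ennreal (D + \<eta>)"
    by (auto simp: delta_minus_def Inf_less_iff)
  then show thesis
    using that[of "a - t"] by (auto simp: ennreal_less_iff D_def)
qed

section \<open>Quantile functions\<close>

definition quantile :: "real measure \<Rightarrow> real \<Rightarrow> real" where
  "quantile \<mu> u = Inf {x. u \<le> cdf \<mu> x}"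

lemma quantile_le_iff:
  assumes "borel_prob \<mu>" "u \<in> {0<..<1}"
  shows "quantile \<mu> u \<le> x \<longleftrightarrow> u \<le> cdf \<mu> x"
proof -
  interpret cdf_distribution \<mu>
    using borel_prob_real_distribution[OF assms(1)] by (simp add: cdf_distribution_def)
  show ?thesis using pseudoinverse[of u x] assms(2) by (simp add: quantile_def)
qed

lemma cdf_quantile:
  assumes "borel_prob \<mu>" "u \<in> {0<..<1}"
  shows "u \<le> cdf \<mu> (quantile \<mu> u)"
  using quantile_le_iff[OF assms] by blast

lemma quantile_mono:
  assumes "borel_prob \<mu>" "u \<in> {0<..<1}" "v \<in> {0<..<1}" "u \<le> v"
  shows "quantile \<mu> u \<le> quantile \<mu> v"
  using quantile_le_iff[OF assms(1,2)] cdf_quantile[OF assms(1,3)] assms(4) by fastforce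

lemma quantile_measurable:
  assumes "borel_prob \<mu>"
  shows "quantile \<mu> \<in> borel_measurable (restrict_space lborel {0<..<1})"
proof -
  interpret cdf_distribution \<mu>
    using borel_prob_real_distribution[OF assms] by (simp add: cdf_distribution_def)
  have "quantile \<mu> \<in> borel_measurable (restrict_space borel {0<..<1})"
    using measurable_CI by (simp add: quantile_def[abs_def])
  then show ?thesis
    by (simp cong: measurable_cong_sets add: sets_restrict_space)
qed

lemma distr_quantile:
  assumes "borel_prob \<mu>"
  shows "distr (restrict_space lborel {0<..<1}) borel (quantile \<mu>) = \<mu>"
proof -
  interpret cdf_distribution \<mu>
    using borel_prob_real_distribution[OF assms] by (simp add: cdf_distribution_def)
  show ?thesis using distr_I_eq_M by (simp add: quantile_def[abs_def])
qed

text \<open>To the left of a quantile the distribution function is strictly smaller.\<close>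

lemma quantile_in_msupp:
  assumes \<mu>: "borel_prob \<mu>" and u: "u \<in> {0<..<1}"
  shows "quantile \<mu> u \<in> msupp \<mu>"
  unfolding msupp_def
proof (safe)
  interpret real_distribution \<mu> using \<mu> by (rule borel_prob_real_distribution)
  fix U :: "real set" assume U: "open U" "quantile \<mu> u \<in> U"
  then obtain e where e: "0 < e" "ball (quantile \<mu> u) e \<subseteq> U"
    by (auto simp: open_contains_ball)
  let ?c = "quantile \<mu> u - e / 2"
  have "{?c<..quantile \<mu> u} \<subseteq> U"
    using e by (auto simp: dist_real_def subset_iff)
  then have "measure \<mu> {?c<..quantile \<mu> u} \<le> measure \<mu> U"
    using U(1) by (intro finite_measure_mono) auto
  moreover have "cdf \<mu> ?c < u"
    using quantile_le_iff[OF \<mu> u, of ?c] e(1) by simp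
  then have "0 < measure \<mu> {?c<..quantile \<mu> u}"
    using cdf_quantile[OF \<mu> u] cdf_diff_eq[of ?c "quantile \<mu> u"] e(1) by simp
  ultimately show "0 < measure \<mu> U" by simp
qed

section \<open>Iso-domination\<close>

lemma iso_dev_le_iff:
  "iso_dev S \<le> ereal s \<longleftrightarrow>
    (\<forall>(x, y)\<in>S. \<forall>(x', y')\<in>S. y \<le> y' + max (x - x') 0 + s)"
  unfolding iso_dev_def Sup_le_iff by (force simp: algebra_simps)

text \<open>
  The range of \<open>(f, g)\<close> need not be Borel; its closure is, and the condition on the deviation is
  closed.
\<close>

lemma iso_dominates_of_parametrization:
  assumes P: "prob_space P"
    and f: "f \<in> borel_measurable P" and g: "g \<in> borel_measurable P"
    and dev: "\<And>u v. u \<in> space P \<Longrightarrow> v \<in> space P \<Longrightarrow> g u \<le> g v + max (f u - f v) 0 + s"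
  shows "iso_dominates s 0 (distr P borel f) (distr P borel g)"
proof -
  let ?h = "\<lambda>u. (f u, g u)"
  let ?\<pi> = "distr P borel ?h" and ?R = "?h ` space P"
  have h: "?h \<in> measurable P borel"
    using f g by (simp add: borel_prod[symmetric])
  interpret \<pi>: prob_space ?\<pi> using P h by (rule prob_space.prob_space_distr)
  have marginals: "distr ?\<pi> borel fst = distr P borel f" "distr ?\<pi> borel snd = distr P borel g"
    using h by (auto simp: distr_distr borel_measurable_continuous_onI continuous_on_fst
        continuous_on_snd comp_def)
  have coupling: "?\<pi> \<in> couplings (distr P borel f) (distr P borel g)"
    using marginals \<pi>.prob_space_axioms by (simp add: couplings_def borel_prob_def)
  let ?K = "{p :: (real \<times> real) \<times> (real \<times> real).
      snd (fst p) \<le> snd (snd p) + max (fst (fst p) - fst (snd p)) 0 + s}"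
  have "closed ?K"
    by (intro closed_Collect_le continuous_intros)
  moreover have "?R \<times> ?R \<subseteq> ?K"
    using dev by auto
  ultimately have "closure ?R \<times> closure ?R \<subseteq> ?K"
    unfolding closure_Times[symmetric] by (intro closure_minimal)
  then have "iso_dev (closure ?R) \<le> ereal s"
    unfolding iso_dev_le_iff by fastforce
  moreover have "measure ?\<pi> (closure ?R) = 1"
  proof -
    have "?h -` closure ?R \<inter> space P = space P"
      using closure_subset[of ?R] by auto
    then show ?thesis
      using h prob_space.prob_space[OF P] by (simp add: measure_distr)
  qed
  ultimately show ?thesis
    unfolding iso_dominates_def using coupling by (intro bexI[of _ ?\<pi>] bexI[of _ "closure ?R"]) auto
qed

lemma iso_dominates_of_quantiles:
  assumes \<nu>: "borel_prob \<nu>" and \<mu>: "borel_prob \<mu>" and "0 \<le> s"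
    and le: "\<And>u v. u \<in> {0<..<1} \<Longrightarrow> v \<in> {0<..<1} \<Longrightarrow> v < u \<Longrightarrow>
      quantile \<mu> u \<le> quantile \<mu> v + (quantile \<nu> u - quantile \<nu> v) + s"
  shows "iso_dominates s 0 \<nu> \<mu>"
proof -
  let ?P = "restrict_space lborel {0<..<1} :: real measure"
  have "prob_space ?P"
    by (auto simp: space_restrict_space emeasure_restrict_space intro!: prob_spaceI)
  then have "iso_dominates s 0 (distr ?P borel (quantile \<nu>)) (distr ?P borel (quantile \<mu>))"
  proof (rule iso_dominates_of_parametrization[OF _ quantile_measurable[OF \<nu>]
        quantile_measurable[OF \<mu>]])
    fix u v assume "u \<in> space ?P" "v \<in> space ?P"
    then have uv: "u \<in> {0<..<1}" "v \<in> {0<..<1}"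
      by (auto simp: space_restrict_space)
    show "quantile \<mu> u \<le> quantile \<mu> v + max (quantile \<nu> u - quantile \<nu> v) 0 + s"
    proof (cases "v < u")
      case True
      then show ?thesis using le[OF uv] by linarith
    next
      case False
      then show ?thesis using quantile_mono[OF \<mu> uv] \<open>0 \<le> s\<close> by linarith
    qed
  qed
  then show ?thesis by (simp add: distr_quantile \<nu> \<mu>)
qed

section \<open>From the isoperimetric condition to domination\<close>

lemma lipschitz_measurable:
  fixes X :: "'a::polish_space measure" and \<phi> :: "'a \<Rightarrow> real"
  assumes "borel_prob X" "1-lipschitz_on UNIV \<phi>"
  shows "\<phi> \<in> borel_measurable X"
proof -
  have "continuous_on UNIV \<phi>"
    using assms(2) by (rule lipschitz_on_continuous_on)
  then have "\<phi> \<in> borel_measurable borel" by (rule borel_measurable_continuous_onI)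
  then show ?thesis using assms(1) by (simp add: borel_prob_def cong: measurable_cong_sets)
qed

lemma borel_prob_distr:
  assumes "borel_prob X" "\<phi> \<in> borel_measurable X"
  shows "borel_prob (distr X borel \<phi>)"
  using assms by (simp add: borel_prob_def prob_space.prob_space_distr)

lemma cdf_distr:
  assumes "borel_prob X" "\<phi> \<in> borel_measurable X"
  shows "cdf (distr X borel \<phi>) t = measure X {z. \<phi> z \<le> t}"
proof -
  have "space X = UNIV"
    using assms(1) sets_eq_imp_space_eq[of X borel] by (simp add: borel_prob_def)
  then show ?thesis
    using assms(2) by (simp add: cdf_def measure_distr vimage_def)
qed

lemma closed_nbhd_sublevel:
  assumes "1-lipschitz_on UNIV \<phi>"
  shows "closed_nbhd r {z. \<phi> z \<le> t} \<subseteq> {z. \<phi> z \<le> t + (r :: real)}"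
proof
  fix y assume y: "y \<in> closed_nbhd r {z. \<phi> z \<le> t}"
  let ?A = "{z. \<phi> z \<le> t}"
  have "\<phi> y - t \<le> infdist y ?A"
  proof -
    have "\<phi> y - t \<le> dist y z" if "z \<in> ?A" for z
      using lipschitz_onD[OF assms, of y z] that by (auto simp: dist_real_def)
    then show ?thesis
      using y by (auto simp: infdist_notempty closed_nbhd_def intro!: cINF_greatest)
  qed
  then show "y \<in> {z. \<phi> z \<le> t + r}" using y by (auto simp: closed_nbhd_def)
qed

text \<open>
  The isoperimetric condition applied to a sublevel set of \<open>\<phi>\<close>, started at any admissible point
  \<open>c\<close> of the support.
\<close>

lemma ICL_quantile_le:
  fixes X :: "'a::polish_space measure"
  assumes X: "borel_prob X" and \<nu>: "borel_prob \<nu>" and ICL: "ICL \<epsilon> \<nu> X"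
    and \<phi>: "1-lipschitz_on UNIV \<phi>"
    and u: "u \<in> {0<..<1}" and c: "c \<in> msupp \<nu>" "c \<le> quantile \<nu> u"
    and pos: "0 < measure X {z. \<phi> z \<le> t}" and cdf_c: "cdf \<nu> c \<le> measure X {z. \<phi> z \<le> t}"
  shows "quantile (distr X borel \<phi>) u \<le> t + (quantile \<nu> u - c) + \<epsilon>"
proof -
  have meas: "\<phi> \<in> borel_measurable X" using X \<phi> by (rule lipschitz_measurable)
  interpret X: prob_space X using X by (simp add: borel_prob_def)
  have sets_X: "sets X = sets borel" and space_X: "space X = UNIV"
    using X sets_eq_imp_space_eq[of X borel] by (auto simp: borel_prob_def)
  have sublevel: "{z. \<phi> z \<le> r} \<in> sets borel" for r
    using borel_measurable_le[OF meas, of "\<lambda>_. r"] by (simp add: space_X sets_X)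
  let ?b = "quantile \<nu> u"
  have "u \<le> cdf \<nu> ?b" using cdf_quantile[OF \<nu> u] .
  also have "\<dots> \<le> measure X (closed_nbhd (?b - c + \<epsilon>) {z. \<phi> z \<le> t})"
    using ICL c quantile_in_msupp[OF \<nu> u] sublevel pos cdf_c unfolding ICL_def by blast
  also have "\<dots> \<le> measure X {z. \<phi> z \<le> t + (?b - c + \<epsilon>)}"
    using closed_nbhd_sublevel[OF \<phi>] sublevel by (intro X.finite_measure_mono) (auto simp: sets_X)
  also have "\<dots> = cdf (distr X borel \<phi>) (t + (?b - c + \<epsilon>))"
    using cdf_distr[OF X meas] by simp
  finally show ?thesis
    using quantile_le_iff[OF borel_prob_distr[OF X meas] u, of "t + (?b - c + \<epsilon>)"] by linarith
qed

theorem ICL_imp_iso_dominant: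
  fixes X :: "'a::polish_space measure"
  assumes X: "borel_prob X" and \<nu>: "borel_prob \<nu>" and "0 \<le> \<epsilon>"
    and atom: "- \<infinity> < inf_supp \<nu> \<Longrightarrow>
      \<forall>x\<in>msupp X. measure \<nu> {real_of_ereal (inf_supp \<nu>)} \<le> measure X {x}"
    and ICL: "ICL \<epsilon> \<nu> X" and finite: "Delta_supp \<nu> < \<infinity>"
  shows "iso_dominant (\<epsilon> + enn2real (Delta_supp \<nu>)) \<nu> X"
  unfolding iso_dominant_def
proof
  fix \<mu> assume "\<mu> \<in> one_measurement X"
  then obtain \<phi> where \<phi>: "1-lipschitz_on UNIV \<phi>" and \<mu>: "\<mu> = distr X borel \<phi>"
    by (auto simp: one_measurement_def)
  have meas: "\<phi> \<in> borel_measurable X" using X \<phi> by (rule lipschitz_measurable)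
  interpret X: prob_space X using X by (simp add: borel_prob_def)
  have sets_X: "sets X = sets borel" and space_X: "space X = UNIV"
    using X sets_eq_imp_space_eq[of X borel] by (auto simp: borel_prob_def)
  have borel_\<mu>: "borel_prob \<mu>" unfolding \<mu> using X meas by (rule borel_prob_distr)
  let ?\<Delta> = "enn2real (Delta_supp \<nu>)"
  show "iso_dominates (\<epsilon> + ?\<Delta>) 0 \<nu> \<mu>"
  proof (rule iso_dominates_of_quantiles[OF \<nu> borel_\<mu>])
    show "0 \<le> \<epsilon> + ?\<Delta>" using \<open>0 \<le> \<epsilon>\<close> by simp
    fix u v :: real assume u: "u \<in> {0<..<1}" and v: "v \<in> {0<..<1}" and "v < u"
    define A where "A = {z. \<phi> z \<le> quantile \<mu> v}"
    have A: "A \<in> sets borel"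
      using borel_measurable_le[OF meas, of "\<lambda>_. quantile \<mu> v"] by (simp add: A_def space_X sets_X)
    have "measure X A = cdf \<mu> (quantile \<mu> v)"
      unfolding \<mu> A_def using cdf_distr[OF X meas] by simp
    then have v_le: "v \<le> measure X A" using cdf_quantile[OF borel_\<mu> v] by simp
    then have pos: "0 < measure X A" using v by simp
    have mono: "quantile \<nu> v \<le> quantile \<nu> u"
      using quantile_mono[OF \<nu> v u] \<open>v < u\<close> by simp
    have bound: "quantile \<mu> u \<le> quantile \<mu> v + (quantile \<nu> u - c) + \<epsilon>"
      if "c \<in> msupp \<nu>" "c \<le> quantile \<nu> v" "cdf \<nu> c \<le> measure X A" for c
      using ICL_quantile_le[OF X \<nu> ICL \<phi> u that(1), of "quantile \<mu> v"] that mono pos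
      unfolding A_def \<mu> by simp
    show "quantile \<mu> u \<le> quantile \<mu> v + (quantile \<nu> u - quantile \<nu> v) + (\<epsilon> + ?\<Delta>)"
    proof (cases "cdf \<nu> (quantile \<nu> v) \<le> measure X A")
      case True
      then show ?thesis
        using bound[OF quantile_in_msupp[OF \<nu> v]] enn2real_nonneg[of "Delta_supp \<nu>"] by linarith
    next
      case False
      have not_inf: "ereal (quantile \<nu> v) \<noteq> inf_supp \<nu>"
      proof
        assume inf: "ereal (quantile \<nu> v) = inf_supp \<nu>"
        obtain x where "x \<in> A" "x \<in> msupp X"
          using positive_measure_meets_msupp[OF X A pos] .
        have "cdf \<nu> (quantile \<nu> v) = measure \<nu> {real_of_ereal (inf_supp \<nu>)}"
          using cdf_inf_supp[OF \<nu> inf] by (simp add: inf[symmetric])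
        also have "\<dots> \<le> measure X {x}"
          using atom \<open>x \<in> msupp X\<close> by (simp add: inf[symmetric])
        also have "\<dots> \<le> measure X A"
          using \<open>x \<in> A\<close> A by (intro X.finite_measure_mono) (auto simp: sets_X)
        finally show False using False by simp
      qed
      show ?thesis
      proof (rule field_le_epsilon)
        fix \<eta> :: real assume "0 < \<eta>"
        then obtain c where c: "c \<in> msupp \<nu>" "c < quantile \<nu> v" "quantile \<nu> v - c < ?\<Delta> + \<eta>"
          using msupp_predecessor_within_Delta[OF quantile_in_msupp[OF \<nu> v] not_inf finite] by blast
        have "cdf \<nu> c \<le> measure X A"
          using quantile_le_iff[OF \<nu> v, of c] c(2) v_le by linarith
        then show "quantile \<mu> u
            \<le> quantile \<mu> v + (quantile \<nu> u - quantile \<nu> v) + (\<epsilon> + ?\<Delta>) + \<eta>"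
          using bound[OF c(1)] c(2,3) by simp
      qed
    qed
  qed
qed

section \<open>From domination to the isoperimetric condition\<close>

text \<open>
  The common consequence of the two hypotheses on the support. The alternative \<open>cdf \<nu> c = 0\<close> is
  there because the least point of a connected support can lack mass.
\<close>

lemma cdf_less_at_msupp:
  assumes \<nu>: "borel_prob \<nu>"
    and supp: "connected (msupp \<nu>) \<or> (\<forall>x\<in>msupp \<nu>. 0 < measure \<nu> {x})"
    and a: "a \<in> msupp \<nu>" and "c < a"
  shows "cdf \<nu> c = 0 \<or> cdf \<nu> c < cdf \<nu> a"
proof (rule disjCI)
  interpret real_distribution \<nu> using \<nu> by (rule borel_prob_real_distribution)
  assume "\<not> cdf \<nu> c < cdf \<nu> a"
  then have null: "measure \<nu> {c<..a} \<le> 0"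
    using cdf_diff_eq[OF \<open>c < a\<close>] by simp
  have "measure \<nu> {a} \<le> measure \<nu> {c<..a}"
    using \<open>c < a\<close> by (intro finite_measure_mono) auto
  then have conn: "connected (msupp \<nu>)"
    using null supp a by fastforce
  show "cdf \<nu> c = 0"
  proof (rule ccontr)
    assume "cdf \<nu> c \<noteq> 0"
    then have "0 < measure \<nu> {..c}" by (simp add: cdf_def zero_less_measure_iff)
    then obtain p where "p \<le> c" "p \<in> msupp \<nu>"
      using positive_measure_meets_msupp[OF \<nu>, of "{..c}"] by auto
    then have "(c + a) / 2 \<in> msupp \<nu>"
      using connected_contains_Icc[OF conn, of p a] a \<open>c < a\<close> by auto
    then have "0 < measure \<nu> {c<..<a}"
      using \<open>c < a\<close> by (auto simp: msupp_def)
    also have "\<dots> \<le> measure \<nu> {c<..a}" by (intro finite_measure_mono) auto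
    finally show False using null by simp
  qed
qed

lemma lipschitz_infdist:
  fixes A :: "'a::metric_space set"
  shows "1-lipschitz_on UNIV (\<lambda>x. infdist x A)"
  using infdist_triangle_abs by (auto intro!: lipschitz_onI simp: dist_real_def)

theorem iso_dominant_imp_ICL:
  fixes X :: "'a::polish_space measure"
  assumes X: "borel_prob X" and \<nu>: "borel_prob \<nu>"
    and strict: "\<And>a c. a \<in> msupp \<nu> \<Longrightarrow> c < a \<Longrightarrow> cdf \<nu> c = 0 \<or> cdf \<nu> c < cdf \<nu> a"
    and dom: "iso_dominant \<epsilon> \<nu> X"
  shows "ICL \<epsilon> \<nu> X"
  unfolding ICL_def
proof (intro ballI impI)
  fix a b and A :: "'a set"
  assume a: "a \<in> msupp \<nu>" and A: "A \<in> sets borel"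
    and asm: "a \<le> b \<and> 0 < measure X A \<and> cdf \<nu> a \<le> measure X A"
  interpret X: prob_space X using X by (simp add: borel_prob_def)
  have sets_X: "sets X = sets borel" using X by (simp add: borel_prob_def)
  have "A \<noteq> {}" using asm by auto
  define \<phi> where "\<phi> = (\<lambda>x. infdist x A)"
  have \<phi>: "1-lipschitz_on UNIV \<phi>" unfolding \<phi>_def by (rule lipschitz_infdist)
  have meas: "\<phi> \<in> borel_measurable X" using X \<phi> by (rule lipschitz_measurable)
  have sublevel: "{z. \<phi> z \<le> r} \<in> sets borel" for r
    unfolding \<phi>_def by (intro borel_closed closed_Collect_le continuous_intros)
  have "iso_dominates \<epsilon> 0 \<nu> (distr X borel \<phi>)"
    using dom \<phi> by (auto simp: iso_dominant_def one_measurement_def)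
  then obtain \<pi> S where \<pi>: "borel_prob \<pi>" and fst_\<pi>: "distr \<pi> borel fst = \<nu>"
    and snd_\<pi>: "distr \<pi> borel snd = distr X borel \<phi>"
    and S: "S \<in> sets borel" and dev: "iso_dev S \<le> ereal \<epsilon>" and full: "1 \<le> measure \<pi> S"
    by (auto simp: iso_dominates_def couplings_def)
  interpret \<pi>: prob_space \<pi> using \<pi> by (simp add: borel_prob_def)
  have sets_\<pi>: "sets \<pi> = sets borel" using \<pi> by (simp add: borel_prob_def)
  have meas_\<pi>: "fst \<in> borel_measurable \<pi>" "snd \<in> borel_measurable \<pi>"
    unfolding measurable_cong_sets[OF sets_\<pi> refl]
    by (intro borel_measurable_continuous_onI continuous_intros)+
  have fst_le: "measure \<pi> {p. fst p \<le> t} = cdf \<nu> t" for t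
    using cdf_distr[OF \<pi> meas_\<pi>(1), of t] fst_\<pi> by simp
  have snd_le: "measure \<pi> {p. snd p \<le> t} = measure X {z. \<phi> z \<le> t}" for t
    using cdf_distr[OF \<pi> meas_\<pi>(2), of t] cdf_distr[OF X meas, of t]
    unfolding snd_\<pi> by (rule trans[OF sym])
  have closed_half: "closed {p :: real \<times> real. fst p \<le> t}" "closed {p :: real \<times> real. snd p \<le> t}" for t
    by (intro closed_Collect_le continuous_intros)+
  have AE_S: "AE p in \<pi>. p \<in> S"
  proof -
    have "measure \<pi> S = 1" using full \<pi>.prob_le_1[of S] by linarith
    then show ?thesis using \<pi>.prob_eq_1[of S] S unfolding sets_\<pi> by blast
  qed
  have above_0: "\<exists>x' y'. (x', y') \<in> S \<and> y' \<le> 0 \<and> a - \<eta> < x'" if "0 < \<eta>" for \<eta>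
  proof (rule ccontr)
    assume "\<not> ?thesis"
    then have left: "p \<in> S \<Longrightarrow> snd p \<le> 0 \<Longrightarrow> fst p \<le> a - \<eta>" for p
      by (cases p) (auto simp: not_less)
    have "measure X A \<le> measure X {z. \<phi> z \<le> 0}"
      using sublevel by (intro X.finite_measure_mono) (auto simp: \<phi>_def sets_X)
    also have "\<dots> = measure \<pi> {p. snd p \<le> 0}" by (simp add: snd_le)
    also have "\<dots> \<le> measure \<pi> {p. fst p \<le> a - \<eta>}"
      using AE_S left closed_half by (intro \<pi>.finite_measure_mono_AE) (auto simp: sets_\<pi>)
    also have "\<dots> = cdf \<nu> (a - \<eta>)" by (rule fst_le)
    finally show False using asm strict[OF a, of "a - \<eta>"] \<open>0 < \<eta>\<close> by linarith
  qed
  have snd_bound: "snd p \<le> b - a + \<epsilon>" if "p \<in> S" "fst p \<le> b" for p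
  proof (rule field_le_epsilon)
    fix \<eta> :: real assume "0 < \<eta>"
    then obtain x' y' where q: "(x', y') \<in> S" "y' \<le> 0" "a - \<eta> < x'"
      using above_0 by blast
    have "snd p \<le> y' + max (fst p - x') 0 + \<epsilon>"
      using dev that(1) q(1) unfolding iso_dev_le_iff by (auto split: prod.splits)
    then show "snd p \<le> b - a + \<epsilon> + \<eta>"
      using q that(2) asm \<open>0 < \<eta>\<close> by linarith
  qed
  have "cdf \<nu> b = measure \<pi> {p. fst p \<le> b}" by (simp add: fst_le)
  also have "\<dots> \<le> measure \<pi> {p. snd p \<le> b - a + \<epsilon>}"
    using AE_S snd_bound closed_half by (intro \<pi>.finite_measure_mono_AE) (auto simp: sets_\<pi>)
  also have "\<dots> = measure X {z. \<phi> z \<le> b - a + \<epsilon>}" by (rule snd_le)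
  also have "{z. \<phi> z \<le> b - a + \<epsilon>} = closed_nbhd (b - a + \<epsilon>) A"
    using \<open>A \<noteq> {}\<close> by (simp add: closed_nbhd_def \<phi>_def)
  finally show "cdf \<nu> b \<le> measure X (closed_nbhd (b - a + \<epsilon>) A)" .
qed

lemma ICL_mono:
  fixes X :: "'a::polish_space measure"
  assumes X: "borel_prob X" and ICL: "ICL \<epsilon> \<nu> X" and "\<epsilon> \<le> \<epsilon>'"
  shows "ICL \<epsilon>' \<nu> X"
proof -
  interpret X: prob_space X using X by (simp add: borel_prob_def)
  have "measure X (closed_nbhd (b - a + \<epsilon>) A) \<le> measure X (closed_nbhd (b - a + \<epsilon>') A)" for a b A
  proof (rule X.finite_measure_mono)
    show "closed_nbhd (b - a + \<epsilon>) A \<subseteq> closed_nbhd (b - a + \<epsilon>') A"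
      using \<open>\<epsilon> \<le> \<epsilon>'\<close> by (auto simp: closed_nbhd_def)
    have "closed (closed_nbhd r A)" for r
      unfolding closed_nbhd_def
      by (intro closed_Collect_conj closed_Collect_const closed_Collect_le continuous_intros)
    then show "closed_nbhd (b - a + \<epsilon>') A \<in> sets X"
      using X by (simp add: borel_prob_def)
  qed
  then show ?thesis using ICL unfolding ICL_def by (meson order_trans)
qed

theorem theorem1p8:
  fixes X :: "'a::polish_space measure" and \<nu> :: "real measure" and \<epsilon> :: real
  assumes "mm_space X" and "borel_prob \<nu>" and "0 \<le> \<epsilon>"
  shows
    "((- \<infinity> < inf_supp \<nu> \<longrightarrow>
          (\<forall>x\<in>msupp X. measure \<nu> {real_of_ereal (inf_supp \<nu>)} \<le> measure X {x})) \<longrightarrow>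
        ICL \<epsilon> \<nu> X \<longrightarrow>
        Delta_supp \<nu> < \<infinity> \<longrightarrow>
        iso_dominant (\<epsilon> + enn2real (Delta_supp \<nu>)) \<nu> X) \<and>
     (connected (msupp \<nu>) \<or> (\<forall>x\<in>msupp \<nu>. 0 < measure \<nu> {x}) \<longrightarrow>
        iso_dominant \<epsilon> \<nu> X \<longrightarrow>
        ICL (2 * \<epsilon>) \<nu> X)"
proof (intro conjI impI)
  have X: "borel_prob X" using assms(1) by (simp add: mm_space_def)
  {
    assume "- \<infinity> < inf_supp \<nu> \<longrightarrow>
        (\<forall>x\<in>msupp X. measure \<nu> {real_of_ereal (inf_supp \<nu>)} \<le> measure X {x})"
      and "ICL \<epsilon> \<nu> X" and "Delta_supp \<nu> < \<infinity>"
    then show "iso_dominant (\<epsilon> + enn2real (Delta_supp \<nu>)) \<nu> X"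
      using ICL_imp_iso_dominant[OF X assms(2,3)] by blast
  next
    assume "connected (msupp \<nu>) \<or> (\<forall>x\<in>msupp \<nu>. 0 < measure \<nu> {x})"
      and "iso_dominant \<epsilon> \<nu> X"
    then have "ICL \<epsilon> \<nu> X"
      using iso_dominant_imp_ICL[OF X assms(2)] cdf_less_at_msupp[OF assms(2)] by blast
    then show "ICL (2 * \<epsilon>) \<nu> X"
      using ICL_mono[OF X] assms(3) by simp
  }
qed

end
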